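(* For every integer $n\ge 3$, $$\varphi(n)=\frac{4}{n^2-3n+2}\,\sum_{j=1}^{n-1}\ \sum_{\substack{1\le k\le n\\ \gcd(k,n)=1}}\left\lfloor\frac{jk}{n}\right\rfloor .$$
   Context: $\varphi(n)$ is Euler's totient function, $\varphi(n)=\#\{k\in\{1,\dots,n-1\}:\gcd(k,n)=1\}$ for $n\ge 2$. $\lfloor x\rfloor$ denotes the integer part (floor) of $x$. *)

theory Defs
  imports Complex_Main "HOL-Number_Theory.Totient"
begin

end

theory Submission
  imports Defs
begin

text \<open>Since \<open>n\<close> does not divide \<open>j k\<close>, the reflection \<open>j \<mapsto> n - j\<close> pairs the floors into sums
  \<open>k - 1\<close>, so the inner sum over \<open>j\<close> is \<open>(n - 1)(k - 1) / 2\<close>. The reflection \<open>k \<mapsto> n - k\<close> of the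
  totatives likewise gives them the mean \<open>n / 2\<close>.\<close>

text \<open>The two fractions add up to \<open>k\<close>, and neither is an integer, so their
  fractional parts add up to exactly 1.\<close>

lemma floor_add_floor_reflect:
  fixes j k n :: nat
  assumes "coprime k n" "0 < j" "j < n"
  shows "\<lfloor>real j * real k / real n\<rfloor> + \<lfloor>real (n - j) * real k / real n\<rfloor> = int k - 1"
proof -
  define q r where "q = (j * k) div n" and "r = (j * k) mod n"
  \<comment> \<open>Coprimality would reduce divisibility to \<open>n dvd j\<close>, impossible for
    \<open>0 < j < n\<close>.\<close>
  have "\<not> n dvd j * k"
    using assms by (metis coprime_commute coprime_dvd_mult_left_iff nat_dvd_not_less)
  then have r: "0 < r" "r < n"
    using assms by (auto simp: r_def dvd_eq_mod_eq_0)
  have "j * k = n * q + r"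
    by (simp add: q_def r_def)
  then have jk: "real j * real k = real n * real q + real r"
    by (metis of_nat_add of_nat_mult)
  have "real j * real k / real n = real q + real r / real n"
    using jk r by (simp add: field_simps)
  then have "\<lfloor>real j * real k / real n\<rfloor> = int q"
    using r by (simp add: floor_eq_iff)
  \<comment> \<open>Since \<open>r / n\<close> lies strictly between 0 and 1, subtracting it from
    the integer \<open>k - q\<close> lowers the floor by one.\<close>
  moreover have "real (n - j) * real k / real n = real k - real q - real r / real n"
    using jk r assms by (simp add: field_simps of_nat_diff)
  then have "\<lfloor>real (n - j) * real k / real n\<rfloor> = int k - int q - 1"
    using r by (simp add: floor_eq_iff)
  ultimately show ?thesis by simp
qed

text \<open>Adding the sum to its own reversal gives \<open>n - 1\<close> pairs, each worth
  \<open>k - 1\<close>; the factor 2 avoids halves.\<close>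

lemma sum_floor_mult_div:
  fixes k n :: nat
  assumes "coprime k n" "0 < n"
  shows "2 * (\<Sum>j = 1..n - 1. real_of_int \<lfloor>real j * real k / real n\<rfloor>) =
    (real n - 1) * (real k - 1)"
proof -
  define f where "f j = real_of_int \<lfloor>real j * real k / real n\<rfloor>" for j :: nat
  have "sum f {1..n - 1} = (\<Sum>j = 1..n - 1. f (n - j))"
    using assms by (subst sum.atLeastAtMost_rev) simp
  then have "2 * sum f {1..n - 1} = (\<Sum>j = 1..n - 1. f j + f (n - j))"
    by (simp add: sum.distrib)
  also have "\<dots> = (\<Sum>j = 1..n - 1. real k - 1)"
  proof (intro sum.cong refl)
    fix j assume "j \<in> {1..n - 1}"
    then have "\<lfloor>real j * real k / real n\<rfloor> + \<lfloor>real (n - j) * real k / real n\<rfloor> = int k - 1"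
      using assms by (intro floor_add_floor_reflect) auto
    then show "f j + f (n - j) = real k - 1"
      unfolding f_def by linarith
  qed
  also have "\<dots> = (real n - 1) * (real k - 1)"
    using assms by (simp add: of_nat_diff)
  finally show ?thesis by (simp add: f_def)
qed

lemma sum_totatives:
  assumes "n \<ge> 2"
  shows "2 * (\<Sum>k\<in>totatives n. real k) = real n * real (totient n)"
proof -
  \<comment> \<open>This needs \<open>n \<ge> 2\<close>: for \<open>n = 1\<close> the totative 1
    equals \<open>n\<close>, and its reflection 0 is not a totative.\<close>
  have less: "k < n" if "k \<in> totatives n" for k
    using that assms by (simp add: totatives_less)
  have reflect: "n - k \<in> totatives n" if "k \<in> totatives n" for k
    using that less[OF that] gcd_diff2_nat[of k n]
    by (simp add: totatives_def coprime_iff_gcd_eq_1 gcd.commute)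
  have "(\<Sum>k\<in>totatives n. real k) = (\<Sum>k\<in>totatives n. real (n - k))"
    by (rule sum.reindex_bij_witness[of _ "\<lambda>k. n - k" "\<lambda>k. n - k"])
      (use less reflect in \<open>auto simp: less_imp_le\<close>)
  then have "2 * (\<Sum>k\<in>totatives n. real k) = (\<Sum>k\<in>totatives n. real k + real (n - k))"
    by (simp add: sum.distrib)
  also have "\<dots> = (\<Sum>k\<in>totatives n. real n)"
    using less by (intro sum.cong refl) (auto simp: of_nat_diff less_imp_le)
  finally show ?thesis by (simp add: totient_def mult.commute)
qed

theorem mainTheorem1:
  fixes n :: nat
  assumes "n \<ge> 3"
  shows "real (totient n) =
    4 / (real n ^ 2 - 3 * real n + 2) *
      (\<Sum>j = 1..n - 1. \<Sum>k \<in> {k \<in> {1..n}. gcd k n = 1}.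
         real_of_int \<lfloor>real j * real k / real n\<rfloor>)"
proof -
  define f where "f j k = real_of_int \<lfloor>real j * real k / real n\<rfloor>" for j k :: nat
  have tot: "{k \<in> {1..n}. gcd k n = 1} = totatives n"
    by (auto simp: totatives_def coprime_iff_gcd_eq_1)
  \<comment> \<open>The 4 splits into two factors 2: one doubles the inner floor sums, the other the
    sum of the totatives.\<close>
  have "4 * (\<Sum>j = 1..n - 1. \<Sum>k\<in>totatives n. f j k) =
      2 * (\<Sum>k\<in>totatives n. 2 * (\<Sum>j = 1..n - 1. f j k))"
    by (subst sum.swap) (simp add: sum_distrib_left)
  also have "\<dots> = 2 * (\<Sum>k\<in>totatives n. (real n - 1) * (real k - 1))"
    using assms unfolding f_def
    by (intro arg_cong[where f = "(*) 2"] sum.cong refl sum_floor_mult_div)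
      (auto simp: totatives_def)
  also have "\<dots> = (real n - 1) * (2 * (\<Sum>k\<in>totatives n. real k) - 2 * real (totient n))"
    by (simp add: sum_distrib_left[symmetric] sum_subtractf totient_def)
  also have "\<dots> = (real n - 1) * (real n - 2) * real (totient n)"
    using assms by (simp add: sum_totatives algebra_simps)
  finally have "4 * (\<Sum>j = 1..n - 1. \<Sum>k\<in>totatives n. f j k) =
      (real n ^ 2 - 3 * real n + 2) * real (totient n)"
    by (simp add: algebra_simps power2_eq_square)
  \<comment> \<open>The roots 1 and 2 of the denominator are excluded by \<open>n \<ge> 3\<close>,
    so dividing by it is legitimate.\<close>
  moreover have "real n ^ 2 - 3 * real n + 2 = (real n - 1) * (real n - 2)"
    by (simp add: algebra_simps power2_eq_square)
  then have "real n ^ 2 - 3 * real n + 2 \<noteq> 0"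
    using assms by simp
  ultimately show ?thesis
    unfolding tot f_def by (simp add: field_simps)
qed

end
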